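(* Let $\sigma\in A^u$. For all $P,Q\in SP_\sigma$, $\mathrm{SSCL}\vdash P=Q$ if and only if $P=^{\mathcal S}_{sse,\sigma}Q$.
   Context: $A$ is a non-empty set of atoms. $A^u$ is the set of finite strings over $A$ in which each atom occurs at most once (each such string represents an ordering of a finite set of atoms); $\epsilon$ is the empty string. $SP_\sigma$ is the set of closed terms $P::=a\mid\mathsf T\mid\mathsf F\mid\neg P\mid P\land_s P\mid P\lor_s P$ with all atoms $a$ occurring in $\sigma$ ($\land_s,\lor_s$ sequential conjunction/disjunction). $\mathrm{SSCL}\vdash s=t$ means $s=t$ is derivable in equational logic from the following equations over $\{\land_s,\lor_s,\neg,\mathsf T,\mathsf F\}\cup A$ extended with Hoare's conditional $x\lhd y\rhd z$: (CP1) $x\lhd\mathsf T\rhd y=x$, (CP2) $x\lhd\mathsf F\rhd y=y$, (CP3) $\mathsf T\lhd x\rhd\mathsf F=x$, (CP4) $x\lhd(y\lhd z\rhd u)\rhd v=(x\lhd y\rhd v)\lhd z\rhd(x\lhd u\rhd v)$, (CPmem) $x\lhd y\rhd(z\lhd u\rhd(v\lhd y\rhd w))=x\lhd y\rhd(z\lhd u\rhd w)$, (CPs) $\mathsf F\lhd x\rhd\mathsf F=\mathsf F$, $\neg x=\mathsf F\lhd x\rhd\mathsf T$, $x\land_s y=y\lhd x\rhd\mathsf F$, $x\lor_s y=\mathsf T\lhd x\rhd y$. Evaluation trees $\mathcal T_A$: generated by $\mathsf T,\mathsf F$ and $X\unlhd a\unrhd Y$ ($a\in A$; root $a$, left branch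 $X$, right branch $Y$); $X[\mathsf T\mapsto Y,\mathsf F\mapsto Z]$ replaces $\mathsf T$-leaves by $Y$ and $\mathsf F$-leaves by $Z$. For closed terms over $\{\lhd\rhd,\mathsf T,\mathsf F\}\cup A$: $se(\mathsf T)=\mathsf T$, $se(\mathsf F)=\mathsf F$, $se(a)=\mathsf T\unlhd a\unrhd\mathsf F$, $se(P\lhd Q\rhd R)=se(Q)[\mathsf T\mapsto se(P),\mathsf F\mapsto se(R)]$. $m:\mathcal T_A\to\mathcal T_A$: $m(\mathsf T)=\mathsf T$, $m(\mathsf F)=\mathsf F$, $m(X\unlhd a\unrhd Y)=m(L_a(X))\unlhd a\unrhd m(R_a(Y))$, where $L_a,R_a$ fix $\mathsf T,\mathsf F$, $L_a(X\unlhd b\unrhd Y)=L_a(X)$ if $b=a$ and $L_a(X)\unlhd b\unrhd L_a(Y)$ otherwise, $R_a(X\unlhd b\unrhd Y)=R_a(Y)$ if $b=a$ and $R_a(X)\unlhd b\unrhd R_a(Y)$ otherwise. $\mathit{mse}^{\mathcal C}(P)=m(se(P))$. Let $E_\epsilon=\mathsf F$ and $E_{a\rho}=E_\rho\lhd a\rhd E_\rho$. For a closed conditional term $P$ with atoms in $\sigma$, $sse^{\mathcal C}_\sigma(P)=\mathit{mse}^{\mathcal C}(\mathsf T\lhd E_\sigma\rhd P)$. The translation $f$: $f(\mathsf T)=\mathsf T$, $f(\mathsf F)=\mathsf F$, $f(a)=a$, $f(\neg t)=\mathsf F\lhd f(t)\rhd\mathsf T$, $f(t_1\land_s t_2)=f(t_2)\lhd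 f(t_1)\rhd\mathsf F$, $f(t_1\lor_s t_2)=\mathsf T\lhd f(t_1)\rhd f(t_2)$. Static $se$-congruence over $\sigma$: for $P,Q\in SP_\sigma$, $P=^{\mathcal S}_{sse,\sigma}Q$ iff $sse^{\mathcal C}_\sigma(f(P))=sse^{\mathcal C}_\sigma(f(Q))$. *)

theory Defs
  imports Main
begin

text \<open>
  The non-empty set of atoms is rendered as an arbitrary type \<open>'a\<close>, and the strings in
  which each atom occurs at most once as the distinct lists over \<open>'a\<close>.
\<close>

datatype (atoms: 'a) sprop =
    Atom 'a
  | Tr
  | Fa
  | Neg "'a sprop"
  | Conj "'a sprop" "'a sprop"
  | Disj "'a sprop" "'a sprop"

definition SP :: "'a list \<Rightarrow> 'a sprop set" where
  "SP \<sigma> = {P. atoms P \<subseteq> set \<sigma>}"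


section \<open>Equational logic and the axioms of SSCL\<close>

text \<open>
  Open terms over the full signature. \<open>Cond x y z\<close> is Hoare's conditional
  \<open>x \<lhd> y \<rhd> z\<close> (if \<open>y\<close> then \<open>x\<close> else \<open>z\<close>): the condition is the middle argument.
\<close>

datatype 'a trm =
    Var nat
  | TAtom 'a
  | TTr
  | TFa
  | TNeg "'a trm"
  | TConj "'a trm" "'a trm"
  | TDisj "'a trm" "'a trm"
  | Cond "'a trm" "'a trm" "'a trm"

primrec subst :: "(nat \<Rightarrow> 'a trm) \<Rightarrow> 'a trm \<Rightarrow> 'a trm" where
  "subst \<theta> (Var n) = \<theta> n"
| "subst \<theta> (TAtom a) = TAtom a"
| "subst \<theta> TTr = TTr"
| "subst \<theta> TFa = TFa"
| "subst \<theta> (TNeg s) = TNeg (subst \<theta> s)"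
| "subst \<theta> (TConj s t) = TConj (subst \<theta> s) (subst \<theta> t)"
| "subst \<theta> (TDisj s t) = TDisj (subst \<theta> s) (subst \<theta> t)"
| "subst \<theta> (Cond s t u) = Cond (subst \<theta> s) (subst \<theta> t) (subst \<theta> u)"

inductive derivable :: "('a trm \<times> 'a trm) set \<Rightarrow> 'a trm \<Rightarrow> 'a trm \<Rightarrow> bool"
  for E :: "('a trm \<times> 'a trm) set"
where
  ax: "(s, t) \<in> E \<Longrightarrow> derivable E s t"
| refl: "derivable E s s"
| sym: "derivable E s t \<Longrightarrow> derivable E t s"
| trans: "derivable E s t \<Longrightarrow> derivable E t u \<Longrightarrow> derivable E s u"
| inst: "derivable E s t \<Longrightarrow> derivable E (subst \<theta> s) (subst \<theta> t)"
| cong_Neg: "derivable E s s' \<Longrightarrow> derivable E (TNeg s) (TNeg s')"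
| cong_Conj: "derivable E s s' \<Longrightarrow> derivable E t t' \<Longrightarrow> derivable E (TConj s t) (TConj s' t')"
| cong_Disj: "derivable E s s' \<Longrightarrow> derivable E t t' \<Longrightarrow> derivable E (TDisj s t) (TDisj s' t')"
| cong_Cond: "derivable E s s' \<Longrightarrow> derivable E t t' \<Longrightarrow> derivable E u u' \<Longrightarrow>
    derivable E (Cond s t u) (Cond s' t' u')"

definition SSCL :: "('a trm \<times> 'a trm) set" where
  "SSCL =
    (let x = Var 0; y = Var 1; z = Var 2; u = Var 3; v = Var 4; w = Var 5 in
     {\<comment> \<open>CP1\<close>   (Cond x TTr y, x),
      \<comment> \<open>CP2\<close>   (Cond x TFa y, y),
      \<comment> \<open>CP3\<close>   (Cond TTr x TFa, x),
      \<comment> \<open>CP4\<close>   (Cond x (Cond y z u) v, Cond (Cond x y v) z (Cond x u v)),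
      \<comment> \<open>CPmem\<close> (Cond x y (Cond z u (Cond v y w)), Cond x y (Cond z u w)),
      \<comment> \<open>CPs\<close>   (Cond TFa x TFa, TFa),
      (TNeg x, Cond TFa x TTr),
      (TConj x y, Cond y x TFa),
      (TDisj x y, Cond TTr x y)})"

primrec trm_of :: "'a sprop \<Rightarrow> 'a trm" where
  "trm_of (Atom a) = TAtom a"
| "trm_of Tr = TTr"
| "trm_of Fa = TFa"
| "trm_of (Neg P) = TNeg (trm_of P)"
| "trm_of (Conj P Q) = TConj (trm_of P) (trm_of Q)"
| "trm_of (Disj P Q) = TDisj (trm_of P) (trm_of Q)"

definition SSCL_proves :: "'a sprop \<Rightarrow> 'a sprop \<Rightarrow> bool" where
  "SSCL_proves P Q \<longleftrightarrow> derivable SSCL (trm_of P) (trm_of Q)"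


section \<open>Evaluation trees\<close>

text \<open>\<open>Node X a Y\<close> has root \<open>a\<close>, left (true) branch \<open>X\<close> and right (false) branch \<open>Y\<close>.\<close>

datatype 'a etree = LT | LF | Node "'a etree" 'a "'a etree"

primrec replace :: "'a etree \<Rightarrow> 'a etree \<Rightarrow> 'a etree \<Rightarrow> 'a etree" where
  "replace LT Y Z = Y"
| "replace LF Y Z = Z"
| "replace (Node X1 a X2) Y Z = Node (replace X1 Y Z) a (replace X2 Y Z)"

primrec Lf :: "'a \<Rightarrow> 'a etree \<Rightarrow> 'a etree" where
  "Lf a LT = LT"
| "Lf a LF = LF"
| "Lf a (Node X b Y) = (if b = a then Lf a X else Node (Lf a X) b (Lf a Y))"

primrec Rf :: "'a \<Rightarrow> 'a etree \<Rightarrow> 'a etree" where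
  "Rf a LT = LT"
| "Rf a LF = LF"
| "Rf a (Node X b Y) = (if b = a then Rf a Y else Node (Rf a X) b (Rf a Y))"

lemma size_Lf_le: "size (Lf a X) \<le> size X"
  by (induction X) auto

lemma size_Rf_le: "size (Rf a X) \<le> size X"
  by (induction X) auto

lemma size_Lf_less [termination_simp]: "size (Lf a X) < Suc (size X + n)"
  using size_Lf_le[of a X] by simp

lemma size_Rf_less [termination_simp]: "size (Rf a X) < Suc (n + size X)"
  using size_Rf_le[of a X] by simp

fun memo :: "'a etree \<Rightarrow> 'a etree" where
  "memo LT = LT"
| "memo LF = LF"
| "memo (Node X a Y) = Node (memo (Lf a X)) a (memo (Rf a Y))"


section \<open>Closed conditional terms and static congruence\<close>

text \<open>As in \<open>Cond\<close>, the condition is the middle argument of \<open>CCond\<close>.\<close>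

datatype 'a cprop = CTr | CFa | CAtom 'a | CCond "'a cprop" "'a cprop" "'a cprop"

primrec se :: "'a cprop \<Rightarrow> 'a etree" where
  "se CTr = LT"
| "se CFa = LF"
| "se (CAtom a) = Node LT a LF"
| "se (CCond P Q R) = replace (se Q) (se P) (se R)"

definition mse :: "'a cprop \<Rightarrow> 'a etree" where
  "mse P = memo (se P)"

primrec E_term :: "'a list \<Rightarrow> 'a cprop" where
  "E_term [] = CFa"
| "E_term (a # \<rho>) = CCond (E_term \<rho>) (CAtom a) (E_term \<rho>)"

definition sse :: "'a list \<Rightarrow> 'a cprop \<Rightarrow> 'a etree" where
  "sse \<sigma> P = mse (CCond CTr (E_term \<sigma>) P)"

primrec cond_of :: "'a sprop \<Rightarrow> 'a cprop" where
  "cond_of (Atom a) = CAtom a"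
| "cond_of Tr = CTr"
| "cond_of Fa = CFa"
| "cond_of (Neg P) = CCond CFa (cond_of P) CTr"
| "cond_of (Conj P Q) = CCond (cond_of Q) (cond_of P) CFa"
| "cond_of (Disj P Q) = CCond CTr (cond_of P) (cond_of Q)"

definition static_cong :: "'a list \<Rightarrow> 'a sprop \<Rightarrow> 'a sprop \<Rightarrow> bool" where
  "static_cong \<sigma> P Q \<longleftrightarrow> sse \<sigma> (cond_of P) = sse \<sigma> (cond_of Q)"

end

theory Submission imports Defs begin

text \<open>
  Both sides of the equivalence say that \<open>P\<close> and \<open>Q\<close> have the same truth value under every
  valuation. The axioms are valid in the two-element algebra. Conversely, CPs gives
  \<open>y \<lhd> x \<rhd> y = y\<close>, so any term may be prefixed with a test of an atom \<open>a\<close>, and CPmem then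
  resolves all later tests of \<open>a\<close>; repeating this for all atoms yields the truth table.
  The tree of \<open>T \<lhd> E\<^sub>\<sigma> \<rhd> P\<close> is, after memorizing, this truth table as well.
\<close>

section \<open>Boolean semantics\<close>

primrec trm_val :: "(nat \<Rightarrow> bool) \<Rightarrow> ('a \<Rightarrow> bool) \<Rightarrow> 'a trm \<Rightarrow> bool" where
  "trm_val r v (Var n) = r n"
| "trm_val r v (TAtom a) = v a"
| "trm_val r v TTr = True"
| "trm_val r v TFa = False"
| "trm_val r v (TNeg s) = (\<not> trm_val r v s)"
| "trm_val r v (TConj s t) = (trm_val r v s \<and> trm_val r v t)"
| "trm_val r v (TDisj s t) = (trm_val r v s \<or> trm_val r v t)"
| "trm_val r v (Cond s t u) = (if trm_val r v t then trm_val r v s else trm_val r v u)"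

primrec tree_val :: "('a \<Rightarrow> bool) \<Rightarrow> 'a etree \<Rightarrow> bool" where
  "tree_val v LT = True"
| "tree_val v LF = False"
| "tree_val v (Node X a Y) = (if v a then tree_val v X else tree_val v Y)"

lemma trm_val_subst: "trm_val r v (subst \<theta> s) = trm_val (\<lambda>n. trm_val r v (\<theta> n)) v s"
  by (induction s) auto

text \<open>The assignment \<open>r\<close> must stay arbitrary: an instantiation step is handled by
  applying the induction hypothesis to the assignment that evaluates each
  \<open>\<theta> n\<close>.\<close>

lemma SSCL_sound: "derivable SSCL s t \<Longrightarrow> trm_val r v s = trm_val r v t"
proof (induction arbitrary: r rule: derivable.induct)
  case (ax s t)
  then show ?case by (auto simp: SSCL_def Let_def split: if_splits)
qed (simp_all add: trm_val_subst)

section \<open>Truth values and atoms of evaluation trees\<close>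

lemma tree_val_replace:
  "tree_val v (replace X Y Z) = (if tree_val v X then tree_val v Y else tree_val v Z)"
  by (induction X) auto

lemma tree_val_Lf: "tree_val v (Lf a X) = tree_val (v(a := True)) X"
  by (induction X) auto

lemma tree_val_Rf: "tree_val v (Rf a X) = tree_val (v(a := False)) X"
  by (induction X) auto

text \<open>The branch \<open>Lf a X\<close> is entered only when \<open>v a\<close> holds, so the
  update \<open>v(a := True)\<close> changes nothing there; dually for \<open>Rf\<close>.\<close>

lemma tree_val_memo: "tree_val v (memo X) = tree_val v X"
  by (induction X rule: memo.induct) (auto simp: tree_val_Lf tree_val_Rf fun_upd_idem)

lemma tree_val_cond_of: "tree_val v (se (cond_of P)) = trm_val r v (trm_of P)"
  by (induction P) (auto simp: tree_val_replace)

lemma tree_val_E_term: "\<not> tree_val v (se (E_term \<sigma>))"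
  by (induction \<sigma>) auto

lemma set_etree_replace: "set_etree (replace X Y Z) \<subseteq> set_etree X \<union> set_etree Y \<union> set_etree Z"
  by (induction X) auto

text \<open>Losing \<open>a\<close> lets the later inductions on \<open>\<sigma>\<close> shrink the
  set of atoms until only leaves remain.\<close>

lemma set_etree_Lf: "set_etree (Lf a X) \<subseteq> set_etree X - {a}"
  by (induction X) auto

lemma set_etree_Rf: "set_etree (Rf a X) \<subseteq> set_etree X - {a}"
  by (induction X) auto

lemma set_etree_cond_of: "set_etree (se (cond_of P)) \<subseteq> atoms P"
proof (induction P)
  case (Neg P)
  then show ?case using set_etree_replace[of "se (cond_of P)" LF LT] by auto
next
  case (Conj P Q)
  then show ?case using set_etree_replace[of "se (cond_of P)" "se (cond_of Q)" LF] by auto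
next
  case (Disj P Q)
  then show ?case using set_etree_replace[of "se (cond_of P)" LT "se (cond_of Q)"] by auto
qed auto


section \<open>Static congruence as semantic equivalence\<close>

lemma Lf_replace: "Lf a (replace X Y Z) = replace (Lf a X) (Lf a Y) (Lf a Z)"
  by (induction X) auto

lemma Rf_replace: "Rf a (replace X Y Z) = replace (Rf a X) (Rf a Y) (Rf a Z)"
  by (induction X) auto

lemma Lf_E_term: "a \<notin> set \<sigma> \<Longrightarrow> Lf a (se (E_term \<sigma>)) = se (E_term \<sigma>)"
  by (induction \<sigma>) auto

lemma Rf_E_term: "a \<notin> set \<sigma> \<Longrightarrow> Rf a (se (E_term \<sigma>)) = se (E_term \<sigma>)"
  by (induction \<sigma>) auto

text \<open>Below the root test of \<open>a\<close>, \<open>memo\<close> applies \<open>Lf a\<close>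
  or \<open>Rf a\<close>. By distinctness this leaves the rest of the prefix intact and acts on
  \<open>X\<close> alone. Each atom of \<open>\<sigma>\<close> thus fixes one more input of
  \<open>X\<close>, and a constant is left at the end of every path.\<close>

lemma memo_E_term_cong:
  assumes "distinct \<sigma>" "set_etree X \<subseteq> set \<sigma>" "set_etree Y \<subseteq> set \<sigma>"
    and "\<And>v. tree_val v X = tree_val v Y"
  shows "memo (replace (se (E_term \<sigma>)) LT X) = memo (replace (se (E_term \<sigma>)) LT Y)"
  using assms
proof (induction \<sigma> arbitrary: X Y)
  case Nil
  \<comment> \<open>Without atoms both trees are leaves, and leaves of equal value coincide.\<close>
  then show ?case by (cases X; cases Y) auto
next
  case (Cons a \<sigma>)
  have "memo (replace (se (E_term \<sigma>)) LT (Lf a X)) = memo (replace (se (E_term \<sigma>)) LT (Lf a Y))"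
    using Cons.prems set_etree_Lf[of a X] set_etree_Lf[of a Y]
    by (intro Cons.IH) (auto simp only: tree_val_Lf list.set distinct.simps)
  moreover have
    "memo (replace (se (E_term \<sigma>)) LT (Rf a X)) = memo (replace (se (E_term \<sigma>)) LT (Rf a Y))"
    using Cons.prems set_etree_Rf[of a X] set_etree_Rf[of a Y]
    by (intro Cons.IH) (auto simp only: tree_val_Rf list.set distinct.simps)
  ultimately show ?case
    using Cons.prems(1) by (simp add: Lf_replace Rf_replace Lf_E_term Rf_E_term)
qed

lemma static_cong_iff_tree_val:
  assumes "distinct \<sigma>" "P \<in> SP \<sigma>" "Q \<in> SP \<sigma>"
  shows "static_cong \<sigma> P Q \<longleftrightarrow>
    (\<forall>v. tree_val v (se (cond_of P)) = tree_val v (se (cond_of Q)))"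
proof
  \<comment> \<open>The prefix always evaluates to false and so hands control to \<open>R\<close>;
    hence the \<open>sse\<close> tree determines the truth function of \<open>R\<close>.\<close>
  have val: "tree_val v (sse \<sigma> R) = tree_val v (se R)" for v and R :: "'a cprop"
    by (simp add: sse_def mse_def tree_val_memo tree_val_replace tree_val_E_term)
  assume "static_cong \<sigma> P Q"
  then show "\<forall>v. tree_val v (se (cond_of P)) = tree_val v (se (cond_of Q))"
    unfolding static_cong_def by (metis val)
next
  assume "\<forall>v. tree_val v (se (cond_of P)) = tree_val v (se (cond_of Q))"
  then show "static_cong \<sigma> P Q"
    using assms set_etree_cond_of[of P] set_etree_cond_of[of Q]
    by (auto simp: static_cong_def sse_def mse_def SP_def intro!: memo_E_term_cong)
qed


section \<open>Derivations in SSCL\<close>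

abbreviation SSCL_eq :: "'a trm \<Rightarrow> 'a trm \<Rightarrow> bool" (infix "\<approx>" 50) where
  "s \<approx> t \<equiv> derivable SSCL s t"

declare derivable.refl [simp]
declare derivable.trans [trans]

text \<open>The axioms use only variables 0 to 5, so a list of six terms serves as the substitution,
  and all nine schemes follow at once.\<close>

lemma SSCL_inst:
  "\<forall>(s, t) \<in> SSCL.
    subst (\<lambda>n. [x, y, z, u, v, w] ! n) s \<approx> subst (\<lambda>n. [x, y, z, u, v, w] ! n) t"
  by (clarify, rule derivable.inst, rule derivable.ax)

lemma
  fixes x y z u v w :: "'a trm"
  shows CP1: "Cond x TTr y \<approx> x"
    and CP2: "Cond x TFa y \<approx> y"
    and CP3: "Cond TTr x TFa \<approx> x"
    and CP4: "Cond x (Cond y z u) v \<approx> Cond (Cond x y v) z (Cond x u v)"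
    and CPmem: "Cond x y (Cond z u (Cond v y w)) \<approx> Cond x y (Cond z u w)"
    and CPs: "Cond TFa x TFa \<approx> TFa"
    and TNeg_eq: "TNeg x \<approx> Cond TFa x TTr"
    and TConj_eq: "TConj x y \<approx> Cond y x TFa"
    and TDisj_eq: "TDisj x y \<approx> Cond TTr x y"
  using SSCL_inst[where x = x and y = y and z = z and u = u and v = v and w = w]
  by (simp_all add: SSCL_def Let_def)

text \<open>CPs is the case of \<open>TFa\<close>; it carries over to any \<open>y\<close> by
  writing \<open>y\<close> as a conditional on \<open>TFa\<close> and merging the two conditions
  with CP4.\<close>

lemma Cond_idem: "Cond y x y \<approx> y"
proof -
  have "Cond y x y \<approx> Cond (Cond y TFa y) x (Cond y TFa y)"
    by (intro derivable.cong_Cond derivable.refl derivable.sym[OF CP2])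
  also have "\<dots> \<approx> Cond y (Cond TFa x TFa) y"
    by (rule derivable.sym[OF CP4])
  also have "\<dots> \<approx> Cond y TFa y"
    by (intro derivable.cong_Cond derivable.refl CPs)
  also have "\<dots> \<approx> y" by (rule CP2)
  finally show ?thesis .
qed

text \<open>Source of the mirror images of CPmem: negating a condition swaps its branches.\<close>

lemma Cond_flip: "Cond x (Cond TFa y TTr) z \<approx> Cond z y x"
proof -
  have "Cond x (Cond TFa y TTr) z \<approx> Cond (Cond x TFa z) y (Cond x TTr z)"
    by (rule CP4)
  also have "\<dots> \<approx> Cond z y x"
    by (intro derivable.cong_Cond derivable.refl CP1 CP2)
  finally show ?thesis .
qed

lemma CPmem_flip_inner: "Cond x y (Cond (Cond v y w) u z) \<approx> Cond x y (Cond w u z)"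
proof -
  have "Cond x y (Cond (Cond v y w) u z) \<approx> Cond x y (Cond z (Cond TFa u TTr) (Cond v y w))"
    by (intro derivable.cong_Cond derivable.refl derivable.sym[OF Cond_flip])
  also have "\<dots> \<approx> Cond x y (Cond z (Cond TFa u TTr) w)"
    by (rule CPmem)
  also have "\<dots> \<approx> Cond x y (Cond w u z)"
    by (intro derivable.cong_Cond derivable.refl Cond_flip)
  finally show ?thesis .
qed

lemma CPmem_right:
  "Cond x y (Cond (Cond v y w) u (Cond v' y w')) \<approx> Cond x y (Cond w u w')"
  using CPmem CPmem_flip_inner by (rule derivable.trans)

text \<open>Flipping every test of \<open>y\<close> turns the claim into \<open>CPmem_right\<close>
  for the negation of \<open>y\<close>.\<close>

lemma CPmem_left:
  "Cond (Cond (Cond v y w) u (Cond v' y w')) y x \<approx> Cond (Cond v u v') y x"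
proof -
  let ?n = "Cond TFa y TTr"
  have "Cond (Cond (Cond v y w) u (Cond v' y w')) y x
      \<approx> Cond x ?n (Cond (Cond w ?n v) u (Cond w' ?n v'))"
    by (rule derivable.trans[OF derivable.sym[OF Cond_flip]])
       (rule derivable.cong_Cond derivable.refl derivable.sym[OF Cond_flip])+
  also have "\<dots> \<approx> Cond x ?n (Cond v u v')"
    by (rule CPmem_right)
  also have "\<dots> \<approx> Cond (Cond v u v') y x"
    by (rule Cond_flip)
  finally show ?thesis .
qed

lemma Cond_contract_right: "Cond x y (Cond v y w) \<approx> Cond x y w"
proof -
  have "Cond x y (Cond v y w) \<approx> Cond x y (Cond (Cond v y w) TTr (Cond v y w))"
    by (intro derivable.cong_Cond derivable.refl derivable.sym[OF CP1])
  also have "\<dots> \<approx> Cond x y (Cond w TTr w)"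
    by (rule CPmem_right)
  also have "\<dots> \<approx> Cond x y w"
    by (intro derivable.cong_Cond derivable.refl CP1)
  finally show ?thesis .
qed

lemma Cond_contract_left: "Cond (Cond v y w) y x \<approx> Cond v y x"
proof -
  have "Cond (Cond v y w) y x \<approx> Cond (Cond (Cond v y w) TTr (Cond v y w)) y x"
    by (intro derivable.cong_Cond derivable.refl derivable.sym[OF CP1])
  also have "\<dots> \<approx> Cond (Cond v TTr v) y x"
    by (rule CPmem_left)
  also have "\<dots> \<approx> Cond v y x"
    by (intro derivable.cong_Cond derivable.refl CP1)
  finally show ?thesis .
qed


section \<open>Completeness\<close>

primrec tree_trm :: "'a etree \<Rightarrow> 'a trm" where
  "tree_trm LT = TTr"
| "tree_trm LF = TFa"
| "tree_trm (Node X a Y) = Cond (tree_trm X) (TAtom a) (tree_trm Y)"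

lemma tree_trm_replace:
  "Cond (tree_trm Y) (tree_trm X) (tree_trm Z) \<approx> tree_trm (replace X Y Z)"
proof (induction X)
  case (Node X1 a X2)
  then show ?case
    by (simp, intro derivable.trans[OF CP4] derivable.cong_Cond derivable.refl)
qed (simp_all add: CP1 CP2)

lemma trm_of_tree_trm: "trm_of P \<approx> tree_trm (se (cond_of P))"
proof (induction P)
  case (Atom a)
  show ?case by (simp add: derivable.sym[OF CP3])
next
  case (Neg P)
  have "TNeg (trm_of P) \<approx> Cond (tree_trm LF) (tree_trm (se (cond_of P))) (tree_trm LT)"
    using Neg by (simp, intro derivable.trans[OF TNeg_eq] derivable.cong_Cond derivable.refl)
  also note tree_trm_replace
  finally show ?case by simp
next
  case (Conj P Q)
  have "TConj (trm_of P) (trm_of Q)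
      \<approx> Cond (tree_trm (se (cond_of Q))) (tree_trm (se (cond_of P))) (tree_trm LF)"
    using Conj by (simp, intro derivable.trans[OF TConj_eq] derivable.cong_Cond derivable.refl)
  also note tree_trm_replace
  finally show ?case by simp
next
  case (Disj P Q)
  have "TDisj (trm_of P) (trm_of Q)
      \<approx> Cond (tree_trm LT) (tree_trm (se (cond_of P))) (tree_trm (se (cond_of Q)))"
    using Disj by (simp, intro derivable.trans[OF TDisj_eq] derivable.cong_Cond derivable.refl)
  also note tree_trm_replace
  finally show ?case by simp
qed auto

text \<open>Syntactic counterpart of memorizing: once \<open>a\<close> has been found true, later
  tests of \<open>a\<close> can be resolved.\<close>

lemma Cond_Lf: "Cond (tree_trm X) (TAtom a) z \<approx> Cond (tree_trm (Lf a X)) (TAtom a) z"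
proof (induction X arbitrary: z)
  case (Node X b Y)
  show ?case
  proof (cases "b = a")
    case True
    then show ?thesis
      using derivable.trans[OF Cond_contract_left Node.IH(1)] by simp
  next
    case False
    let ?a = "TAtom a" and ?b = "TAtom b"
    have "Cond (Cond (tree_trm X) ?b (tree_trm Y)) ?a z
        \<approx> Cond (Cond (Cond (tree_trm X) ?a z) ?b (Cond (tree_trm Y) ?a z)) ?a z"
      \<comment> \<open>Read backwards, the law inserts tests of \<open>a\<close> above both
        subtrees, which puts them in the context required by the induction hypotheses; afterwards
        these tests are removed again.\<close>
      by (rule derivable.sym[OF CPmem_left])
    also have "\<dots> \<approx>
        Cond (Cond (Cond (tree_trm (Lf a X)) ?a z) ?b (Cond (tree_trm (Lf a Y)) ?a z)) ?a z"
      by (intro derivable.cong_Cond derivable.refl Node.IH)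
    also have "\<dots> \<approx> Cond (Cond (tree_trm (Lf a X)) ?b (tree_trm (Lf a Y))) ?a z"
      by (rule CPmem_left)
    finally show ?thesis using False by simp
  qed
qed auto

lemma Cond_Rf: "Cond z (TAtom a) (tree_trm X) \<approx> Cond z (TAtom a) (tree_trm (Rf a X))"
proof (induction X arbitrary: z)
  case (Node X b Y)
  show ?case
  proof (cases "b = a")
    case True
    then show ?thesis
      using derivable.trans[OF Cond_contract_right Node.IH(2)] by simp
  next
    case False
    let ?a = "TAtom a" and ?b = "TAtom b"
    have "Cond z ?a (Cond (tree_trm X) ?b (tree_trm Y))
        \<approx> Cond z ?a (Cond (Cond z ?a (tree_trm X)) ?b (Cond z ?a (tree_trm Y)))"
      by (rule derivable.sym[OF CPmem_right])
    also have "\<dots> \<approx>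
        Cond z ?a (Cond (Cond z ?a (tree_trm (Rf a X))) ?b (Cond z ?a (tree_trm (Rf a Y))))"
      by (intro derivable.cong_Cond derivable.refl Node.IH)
    also have "\<dots> \<approx> Cond z ?a (Cond (tree_trm (Rf a X)) ?b (tree_trm (Rf a Y)))"
      by (rule CPmem_right)
    finally show ?thesis using False by simp
  qed
qed auto

text \<open>Shannon expansion at \<open>a\<close>: \<open>Cond_idem\<close> introduces the test,
  then each branch is restricted.\<close>

lemma tree_trm_expand:
  "tree_trm X \<approx> Cond (tree_trm (Lf a X)) (TAtom a) (tree_trm (Rf a X))"
  by (rule derivable.trans[OF derivable.sym[OF Cond_idem] derivable.trans[OF Cond_Lf Cond_Rf]])

text \<open>Expanding both trees at the same atom reduces the claim to restrictions with fewer
  atoms, which still agree under all valuations.\<close>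

lemma tree_trm_complete:
  assumes "set_etree X \<subseteq> set \<sigma>" "set_etree Y \<subseteq> set \<sigma>"
    and "\<And>v. tree_val v X = tree_val v Y"
  shows "tree_trm X \<approx> tree_trm Y"
  using assms
proof (induction \<sigma> arbitrary: X Y)
  case Nil
  then show ?case by (cases X; cases Y) auto
next
  case (Cons a \<sigma>)
  have L: "tree_trm (Lf a X) \<approx> tree_trm (Lf a Y)"
    using Cons.prems set_etree_Lf[of a X] set_etree_Lf[of a Y]
    by (intro Cons.IH) (auto simp only: tree_val_Lf list.set distinct.simps)
  have R: "tree_trm (Rf a X) \<approx> tree_trm (Rf a Y)"
    using Cons.prems set_etree_Rf[of a X] set_etree_Rf[of a Y]
    by (intro Cons.IH) (auto simp only: tree_val_Rf list.set distinct.simps)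
  note tree_trm_expand[of X a]
  also have "Cond (tree_trm (Lf a X)) (TAtom a) (tree_trm (Rf a X))
      \<approx> Cond (tree_trm (Lf a Y)) (TAtom a) (tree_trm (Rf a Y))"
    by (intro derivable.cong_Cond derivable.refl L R)
  also note derivable.sym[OF tree_trm_expand[of Y a]]
  finally show ?case .
qed

theorem theorem6p10:
  fixes \<sigma> :: "'a list" and P Q :: "'a sprop"
  assumes "distinct \<sigma>"
    and "P \<in> SP \<sigma>" and "Q \<in> SP \<sigma>"
  shows "SSCL_proves P Q \<longleftrightarrow> static_cong \<sigma> P Q"
proof
  assume "SSCL_proves P Q"
  then show "static_cong \<sigma> P Q"
    unfolding static_cong_iff_tree_val[OF assms] SSCL_proves_def
    by (metis SSCL_sound tree_val_cond_of)
next
  assume "static_cong \<sigma> P Q"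
  then have "tree_val v (se (cond_of P)) = tree_val v (se (cond_of Q))" for v
    unfolding static_cong_iff_tree_val[OF assms] by blast
  then have "tree_trm (se (cond_of P)) \<approx> tree_trm (se (cond_of Q))"
    using assms set_etree_cond_of[of P] set_etree_cond_of[of Q]
    by (intro tree_trm_complete[of _ \<sigma>]) (auto simp: SP_def)
  then show "SSCL_proves P Q"
    unfolding SSCL_proves_def
    by (meson derivable.sym derivable.trans trm_of_tree_trm)
qed

end
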